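(* Let $n\ge1$ and $k\ge0$. The Zeta polynomial of the poset $\mathscr{P}^{\mathbb{B}}_{n,k}$ is $\binom{n(u-1)+k}{k}$ (as a polynomial in $u$).
   Context: $\mathscr{P}^{\mathbb{B}}_{n,k}$ is the set of $n$-tuples $(x_1,\dots,x_n)$ of nonnegative integers with $\sum_ix_i\le k$, ordered term-wise. The Zeta polynomial of a finite poset $P$ is the polynomial $Z(u)$ such that for every integer $q\ge2$, $Z(q)$ is the number of multichains $e_1\le\cdots\le e_{q-1}$ in $P$. *)

theory Defs
  imports Complex_Main "HOL-Computational_Algebra.Polynomial"
begin

definition multichains :: "'a set \<Rightarrow> 'a rel \<Rightarrow> nat \<Rightarrow> 'a list set" where
  "multichains A r m =
    {es. length es = m \<and> set es \<subseteq> A \<and> sorted_wrt (\<lambda>x y. (x, y) \<in> r) es}"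

text \<open>
  The Zeta polynomial of a finite poset, given by its carrier \<open>A\<close> and its order relation \<open>r\<close>,
  as a predicate; it has at most one solution by \<open>is_zeta_polynomial_unique\<close>.
\<close>

definition is_zeta_polynomial :: "'a set \<Rightarrow> 'a rel \<Rightarrow> rat poly \<Rightarrow> bool" where
  "is_zeta_polynomial A r Z \<longleftrightarrow>
    (\<forall>q::nat. q \<ge> 2 \<longrightarrow> poly Z (of_nat q) = of_nat (card (multichains A r (q - 1))))"

lemma finite_multichains: "finite A \<Longrightarrow> finite (multichains A r m)"
  unfolding multichains_def
  by (rule finite_subset[OF _ finite_lists_length_eq[of A m]]) auto

lemma is_zeta_polynomial_unique:
  assumes "is_zeta_polynomial A r Z" "is_zeta_polynomial A r Z'"
  shows "Z = Z'"
proof (rule ccontr)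
  assume "Z \<noteq> Z'"
  hence "finite {x. poly (Z - Z') x = 0}"
    by (intro poly_roots_finite) simp
  moreover have "of_nat ` {2::nat..} \<subseteq> {x. poly (Z - Z') x = 0}"
    using assms by (auto simp: is_zeta_polynomial_def)
  ultimately have "finite ((of_nat :: nat \<Rightarrow> rat) ` {2..})"
    using finite_subset by blast
  moreover have "inj_on (of_nat :: nat \<Rightarrow> rat) {2..}"
    by (simp add: inj_on_def)
  ultimately show False
    using finite_imageD infinite_Ici by blast
qed

text \<open>Tuples are lists, so with nonnegative integer entries by typing.\<close>

definition bounded_tuples :: "nat \<Rightarrow> nat \<Rightarrow> nat list set" where
  "bounded_tuples n k = {x. length x = n \<and> sum_list x \<le> k}"

definition termwise_le :: "nat \<Rightarrow> nat \<Rightarrow> nat list rel" where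
  "termwise_le n k =
    {(x, y). x \<in> bounded_tuples n k \<and> y \<in> bounded_tuples n k \<and> list_all2 (\<le>) x y}"

lemma finite_bounded_tuples: "finite (bounded_tuples n k)"
proof (rule finite_subset)
  show "bounded_tuples n k \<subseteq> {x. set x \<subseteq> {..k} \<and> length x = n}"
    unfolding bounded_tuples_def using member_le_sum_list order_trans by fastforce
  show "finite {x. set x \<subseteq> {..k} \<and> length x = n}"
    by (rule finite_lists_length_eq) simp
qed

lemma partial_order_termwise_le: "partial_order_on (bounded_tuples n k) (termwise_le n k)"
  unfolding partial_order_on_def preorder_on_def refl_on_def trans_def antisym_def termwise_le_def
  by (auto intro: list_all2_refl list_all2_antisym[where P = "(\<le>)" and Q = "(\<le>)"]
      list_all2_trans[where ?P1.0 = "(\<le>)" and ?P2.0 = "(\<le>)"])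

text \<open>
  The generalized binomial coefficient \<open>(gchoose)\<close> is only available over fields of characteristic 0;
  this is its version with a polynomial as upper argument.
\<close>

definition gbinomial_poly :: "rat poly \<Rightarrow> nat \<Rightarrow> rat poly" where
  "gbinomial_poly p k = smult (1 / fact k) (\<Prod>i = 0..<k. p - of_nat i)"

lemma poly_gbinomial_poly: "poly (gbinomial_poly p k) u = poly p u gchoose k"
  by (simp add: gbinomial_poly_def gbinomial_prod_rev poly_prod)

end

theory Submission
  imports Defs
begin

text \<open>
  A multichain of \<open>m\<close> tuples of length \<open>n\<close> is determined by its successive differences, which
  concatenate to an arbitrary tuple of length \<open>n * m\<close> with sum at most \<open>k\<close>. Adding a slack entry
  turns the bound on the sum into an equality, so stars and bars gives \<open>(n * m + k) choose k\<close>.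
\<close>

lemma card_bounded_tuples: "card (bounded_tuples n k) = (n + k) choose k"
proof -
  have "bij_betw (\<lambda>l. (k - sum_list l) # l) (bounded_tuples n k)
          {l. length l = Suc n \<and> sum_list l = k}"
    by (rule bij_betw_byWitness[where f' = tl])
      (auto simp: bounded_tuples_def length_Suc_conv)
  then have "card (bounded_tuples n k) = card {l. length l = Suc n \<and> sum_list l = k}"
    by (rule bij_betw_same_card)
  then show ?thesis
    by (simp add: card_length_sum_list add.commute)
qed

text \<open>Cutting a tuple after position \<open>n\<close> leaves a head \<open>d\<close>, and the
  tail may only spend what \<open>d\<close> leaves of the budget \<open>k\<close>. This is the
  recursion that peels one difference off a multichain.\<close>

lemma card_bounded_tuples_add:
  "card (bounded_tuples (n + m) k) = (\<Sum>d\<in>bounded_tuples n k. card (bounded_tuples m (k - sum_list d)))"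
proof -
  have "bij_betw (\<lambda>(d, l). d @ l)
          (SIGMA d:bounded_tuples n k. bounded_tuples m (k - sum_list d)) (bounded_tuples (n + m) k)"
  proof (rule bij_betw_byWitness[where f' = "\<lambda>l. (take n l, drop n l)"])
    show "(\<lambda>l. (take n l, drop n l)) ` bounded_tuples (n + m) k
        \<subseteq> (SIGMA d:bounded_tuples n k. bounded_tuples m (k - sum_list d))"
    proof clarify
      fix l
      assume l: "l \<in> bounded_tuples (n + m) k"
      have "sum_list (take n l) + sum_list (drop n l) = sum_list l"
        by (metis append_take_drop_id sum_list_append)
      moreover have "sum_list l \<le> k"
        using l by (simp add: bounded_tuples_def)
      ultimately have "sum_list (take n l) \<le> k" "sum_list (drop n l) \<le> k - sum_list (take n l)"
        by linarith+
      with l show "take n l \<in> bounded_tuples n k \<and> drop n l \<in> bounded_tuples m (k - sum_list (take n l))"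
        by (simp add: bounded_tuples_def)
    qed
  qed (auto simp: bounded_tuples_def)
  then have "card (bounded_tuples (n + m) k)
      = card (SIGMA d:bounded_tuples n k. bounded_tuples m (k - sum_list d))"
    by (simp add: bij_betw_same_card)
  then show ?thesis
    by (simp add: card_SigmaI finite_bounded_tuples)
qed

lemma sum_list_map2_plus:
  fixes xs ys :: "'a::comm_monoid_add list"
  assumes "length xs = length ys"
  shows "sum_list (map2 (+) xs ys) = sum_list xs + sum_list ys"
  using assms by (induction xs ys rule: list_induct2) (auto simp: ac_simps)

text \<open>An element above \<open>p\<close> is the same as its difference from \<open>p\<close>.
  Sums are additive under termwise addition, so the bound \<open>k\<close> on the element becomes
  the bound \<open>k - sum_list p\<close> on the difference.\<close>

lemma bij_betw_add_termwise_above: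
  assumes "p \<in> bounded_tuples n k"
  shows "bij_betw (map2 (+) p) (bounded_tuples n (k - sum_list p)) {e. (p, e) \<in> termwise_le n k}"
proof (rule bij_betw_byWitness[where f' = "\<lambda>e. map2 (-) e p"])
  \<comment> \<open>Subtraction on naturals truncates, so this direction relies on \<open>p\<close>
    lying below \<open>e\<close>; in the other direction equal lengths suffice.\<close>
  have add_diff: "map2 (+) p (map2 (-) e p) = e" if "list_all2 (\<le>) p e" for p e :: "nat list"
    using that by induction auto
  show "\<forall>d\<in>bounded_tuples n (k - sum_list p). map2 (-) (map2 (+) p d) p = d"
    using assms by (auto simp: bounded_tuples_def intro!: nth_equalityI)
  show "\<forall>e\<in>{e. (p, e) \<in> termwise_le n k}. map2 (+) p (map2 (-) e p) = e"
    by (auto simp: termwise_le_def add_diff)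
  show "map2 (+) p ` bounded_tuples n (k - sum_list p) \<subseteq> {e. (p, e) \<in> termwise_le n k}"
    using assms
    by (auto simp: bounded_tuples_def termwise_le_def sum_list_map2_plus list_all2_conv_all_nth)
  show "(\<lambda>e. map2 (-) e p) ` {e. (p, e) \<in> termwise_le n k} \<subseteq> bounded_tuples n (k - sum_list p)"
  proof clarify
    fix e
    assume pe: "(p, e) \<in> termwise_le n k"
    then have "sum_list p + sum_list (map2 (-) e p) = sum_list e"
      using sum_list_map2_plus[of p "map2 (-) e p"] add_diff[of p e]
      by (auto simp: termwise_le_def bounded_tuples_def)
    then show "map2 (-) e p \<in> bounded_tuples n (k - sum_list p)"
      using pe by (auto simp: termwise_le_def bounded_tuples_def)
  qed
qed

text \<open>\<open>sorted_wrt\<close> compares all pairs, but by transitivity \<open>p\<close> lies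
  below the whole chain as soon as it lies below its first entry \<open>e\<close>. The inclusion in
  \<open>A \<times> A\<close> recovers that \<open>p\<close> belongs to \<open>A\<close>.\<close>

lemma multichains_above_Suc:
  assumes "trans r" "r \<subseteq> A \<times> A"
  shows "{es. p # es \<in> multichains A r (Suc (Suc m))}
    = (\<lambda>(e, es). e # es) ` (SIGMA e:{e. (p, e) \<in> r}. {es. e # es \<in> multichains A r (Suc m)})"
  using assms
  by (force simp: multichains_def length_Suc_conv dest: transD)

text \<open>The chain is counted from a prescribed start \<open>p\<close>, so that the induction on
  \<open>m\<close> can move the start to the next entry. The remaining \<open>m\<close> differences
  share the budget that \<open>p\<close> leaves.\<close>

lemma card_multichains_above:
  assumes "p \<in> bounded_tuples n k"
  shows "card {es. p # es \<in> multichains (bounded_tuples n k) (termwise_le n k) (Suc m)}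
    = card (bounded_tuples (n * m) (k - sum_list p))"
  using assms
proof (induction m arbitrary: p)
  case 0
  then have "{es. p # es \<in> multichains (bounded_tuples n k) (termwise_le n k) (Suc 0)} = {[]}"
    by (auto simp: multichains_def)
  then show ?case
    by (simp add: card_bounded_tuples)
next
  case (Suc m)
  let ?B = "bounded_tuples n k" and ?r = "termwise_le n k"
  let ?C = "\<lambda>m p. {es. p # es \<in> multichains ?B ?r (Suc m)}"
  have r: "trans ?r" "?r \<subseteq> ?B \<times> ?B"
    using partial_order_termwise_le[of n k]
    by (auto simp: partial_order_on_def preorder_on_def termwise_le_def)
  have fin: "finite {e. (p, e) \<in> ?r}" for p
    by (rule finite_subset[OF _ finite_bounded_tuples[of n k]]) (auto simp: termwise_le_def)
  \<comment> \<open>Each member is the \<open>tl\<close> of one of finitely many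
    multichains.\<close>
  have fin': "finite (?C m e)" for e
    by (rule finite_subset[OF _ finite_imageI[OF finite_multichains[OF finite_bounded_tuples], of tl]])
      (auto intro: rev_image_eqI)
  have "card (?C (Suc m) p) = card (SIGMA e:{e. (p, e) \<in> ?r}. ?C m e)"
    unfolding multichains_above_Suc[OF r] by (rule card_image) (auto simp: inj_on_def)
  also have "\<dots> = (\<Sum>e | (p, e) \<in> ?r. card (?C m e))"
    using fin fin' by (simp add: card_SigmaI)
  also have "\<dots> = (\<Sum>e | (p, e) \<in> ?r. card (bounded_tuples (n * m) (k - sum_list e)))"
    using Suc.IH by (intro sum.cong) (auto simp: termwise_le_def)
  \<comment> \<open>Sum over the first difference \<open>d\<close> instead of the next entry
    \<open>e\<close>.\<close>
  also have "\<dots> = (\<Sum>d\<in>bounded_tuples n (k - sum_list p).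
      card (bounded_tuples (n * m) (k - sum_list (map2 (+) p d))))"
    by (rule sum.reindex_bij_betw[OF bij_betw_add_termwise_above[OF Suc.prems], symmetric])
  also have "\<dots> = (\<Sum>d\<in>bounded_tuples n (k - sum_list p).
      card (bounded_tuples (n * m) (k - sum_list p - sum_list d)))"
    using Suc.prems by (intro sum.cong) (auto simp: bounded_tuples_def sum_list_map2_plus)
  \<comment> \<open>Gluing \<open>d\<close> to the later differences gives a tuple of length
    \<open>n + n * m\<close>.\<close>
  also have "\<dots> = card (bounded_tuples (n * Suc m) (k - sum_list p))"
    by (simp add: card_bounded_tuples_add)
  finally show ?case .
qed

lemma card_multichains_bounded_tuples:
  "card (multichains (bounded_tuples n k) (termwise_le n k) m) = (n * m + k) choose k"
proof -
  \<comment> \<open>The zero tuple is the least element: prepending it to a multichain is always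
    allowed, and as a start it leaves the full budget \<open>k\<close>.\<close>
  let ?z = "replicate n (0::nat)"
  have z: "?z \<in> bounded_tuples n k"
    by (simp add: bounded_tuples_def sum_list_replicate)
  have "(?z, e) \<in> termwise_le n k" if "e \<in> bounded_tuples n k" for e
    using z that by (auto simp: termwise_le_def bounded_tuples_def list_all2_conv_all_nth)
  then have "multichains (bounded_tuples n k) (termwise_le n k) m
      = {es. ?z # es \<in> multichains (bounded_tuples n k) (termwise_le n k) (Suc m)}"
    using z by (auto simp: multichains_def)
  then show ?thesis
    using card_multichains_above[OF z, of m] by (simp add: card_bounded_tuples sum_list_replicate)
qed

theorem theorem7p2:
  fixes n k :: nat
  assumes "n \<ge> 1"
  shows "is_zeta_polynomial (bounded_tuples n k) (termwise_le n k)
           (gbinomial_poly (of_nat n * ([:0, 1:] - 1) + of_nat k) k)"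
  unfolding is_zeta_polynomial_def
proof (intro allI impI)
  fix q :: nat
  assume "q \<ge> 2"
  \<comment> \<open>\<open>[:0, 1:]\<close> is the variable u. As \<open>q\<close> is positive,
    \<open>q - 1\<close> on naturals does not truncate and agrees with the rational
    difference.\<close>
  then have "poly (of_nat n * ([:0, 1:] - 1) + of_nat k) (of_nat q) = (of_nat (n * (q - 1) + k) :: rat)"
    by (simp add: of_nat_diff)
  then show "poly (gbinomial_poly (of_nat n * ([:0, 1:] - 1) + of_nat k) k) (of_nat q)
      = of_nat (card (multichains (bounded_tuples n k) (termwise_le n k) (q - 1)))"
    by (simp only: poly_gbinomial_poly card_multichains_bounded_tuples binomial_gbinomial)
qed

end
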